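(* Let $\{Y_t(\mathbf{s}) : \mathbf{s}\in\mathbb{R}^d,\ t\in\mathbb{Z}\}$ be a real-valued spatio-temporal random process that is intrinsically stationary in space and time, with spatio-temporal variogram $\gamma(\mathbf{h},u)$. Fix $\mathbf{s},\mathbf{h}\in\mathbb{R}^d$ and $n\geq 1$, and let $X_t^{\mathbf{h}}(\mathbf{s})=Y_t(\mathbf{s})-Y_t(\mathbf{s}+\mathbf{h})$, $t=1,\dots,n$, with discrete Fourier transform $$J^{x}_{\mathbf{s},\mathbf{s}+\mathbf{h}}(\omega)=\frac{1}{\sqrt{2\pi n}}\sum_{t=1}^{n}X_t^{\mathbf{h}}(\mathbf{s})e^{-it\omega},\qquad |\omega|\le\pi .$$ Let $G^{x}_{\mathbf{s},\mathbf{s}+\mathbf{h}}(\omega)=E|J^{x}_{\mathbf{s},\mathbf{s}+\mathbf{h}}(\omega)|^{2}$ be the frequency variogram. Then $$\int_{-\pi}^{\pi}G^{x}_{\mathbf{s},\mathbf{s}+\mathbf{h}}(\omega)\,d\omega=\gamma(\mathbf{h},0).$$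
   Context: The process $\{Y_t(\mathbf{s})\}$ is called intrinsically stationary in space and time if for all $\mathbf{s},\mathbf{h}\in\mathbb{R}^d$ and $t,u\in\mathbb{Z}$ one has $E[Y_t(\mathbf{s})-Y_{t+u}(\mathbf{s}+\mathbf{h})]=0$ and $\mathrm{Var}[Y_t(\mathbf{s})-Y_{t+u}(\mathbf{s}+\mathbf{h})]=\gamma(\mathbf{h},u)<\infty$, a quantity depending only on $(\mathbf{h},u)$ and not on $(\mathbf{s},t)$. The function $\gamma(\mathbf{h},u)$ is the spatio-temporal variogram. The process $\{Y_t(\mathbf{s})\}$ itself is not assumed to be stationary. *)

theory Defs
  imports "HOL-Probability.Probability"
begin

(* Y t s is the random variable Y_t(s).  The two integrability conjuncts say that the mean
   exists and the variance is finite; the Bochner integral alone would return 0 otherwise. *)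
definition intrinsically_stationary ::
  "'w measure \<Rightarrow> (int \<Rightarrow> real ^ 'd \<Rightarrow> 'w \<Rightarrow> real) \<Rightarrow> (real ^ 'd \<Rightarrow> int \<Rightarrow> real) \<Rightarrow> bool" where
  "intrinsically_stationary M Y \<gamma> \<longleftrightarrow>
     (\<forall>s h t u. let D = (\<lambda>w. Y t s w - Y (t + u) (s + h) w) in
        integrable M D \<and>
        prob_space.expectation M D = 0 \<and>
        integrable M (\<lambda>w. (D w - prob_space.expectation M D)\<^sup>2) \<and>
        prob_space.variance M D = \<gamma> h u)"

definition spatial_increment ::
  "(int \<Rightarrow> real ^ 'd \<Rightarrow> 'w \<Rightarrow> real) \<Rightarrow> real ^ 'd \<Rightarrow> real ^ 'd \<Rightarrow> int \<Rightarrow> 'w \<Rightarrow> real" where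
  "spatial_increment Y h s t w = Y t s w - Y t (s + h) w"

definition dft :: "nat \<Rightarrow> (int \<Rightarrow> 'w \<Rightarrow> real) \<Rightarrow> real \<Rightarrow> 'w \<Rightarrow> complex" where
  "dft n X \<omega> w =
     complex_of_real (1 / sqrt (2 * pi * real n)) *
     (\<Sum>t\<in>{1..int n}. complex_of_real (X t w) * exp (- (\<i> * of_int t * complex_of_real \<omega>)))"

definition frequency_variogram ::
  "'w measure \<Rightarrow> (int \<Rightarrow> real ^ 'd \<Rightarrow> 'w \<Rightarrow> real) \<Rightarrow> nat \<Rightarrow> real ^ 'd \<Rightarrow> real ^ 'd \<Rightarrow> real \<Rightarrow> real" where
  "frequency_variogram M Y n h s \<omega> =
     prob_space.expectation M (\<lambda>w. (cmod (dft n (spatial_increment Y h s) \<omega> w))\<^sup>2)"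

end

theory Submission
  imports Defs
begin

text \<open>
  The result is Parseval's identity under the expectation.  Expanding the squared modulus of the
  discrete Fourier transform gives a trigonometric polynomial in \<open>\<omega>\<close>,
  \<open>(\<Sum>t. \<Sum>u. X\<^sub>t X\<^sub>u cos ((t - u) \<omega>)) / (2 \<pi> n)\<close>, whose coefficients are products of increments.
  Taking expectations replaces each product by the finite number \<open>E [X\<^sub>t X\<^sub>u]\<close>; since the sum is
  finite, this is mere linearity, and no expectation has to be exchanged with the integral over
  \<open>\<omega>\<close>.  Finiteness of \<open>E [X\<^sub>t X\<^sub>u]\<close> follows from that of the second moments
  (\<open>integrable_mult_of_square_integrable\<close>).  Integrating over a full period then annihilates
  every term with \<open>t \<noteq> u\<close>, and each of the \<open>n\<close> diagonal terms
  contributes \<open>E [X\<^sub>t\<^sup>2] / n = \<gamma> h 0 / n\<close>: the temporal correlation of the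
  increments shapes the frequency variogram but not its total mass.
\<close>

text \<open>
  The real coefficients make the sine contributions of \<open>(t, u)\<close> and \<open>(u, t)\<close> cancel, so
  only cosines survive.
\<close>
lemma cmod_trig_poly_squared:
  fixes x :: "int \<Rightarrow> real"
  shows "(cmod (\<Sum>t\<in>A. complex_of_real (x t) * exp (- (\<i> * of_int t * complex_of_real \<omega>))))\<^sup>2
       = (\<Sum>t\<in>A. \<Sum>u\<in>A. x t * x u * cos (of_int (t - u) * \<omega>))"
proof -
  have "exp (- (\<i> * of_int t * complex_of_real \<omega>)) = cis (- (of_int t * \<omega>))" for t :: int
    by (simp add: cis_conv_exp mult.assoc)
  then have "(cmod (\<Sum>t\<in>A. complex_of_real (x t) * exp (- (\<i> * of_int t * complex_of_real \<omega>))))\<^sup>2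
      = (\<Sum>t\<in>A. x t * cos (of_int t * \<omega>))\<^sup>2 + (\<Sum>t\<in>A. x t * sin (of_int t * \<omega>))\<^sup>2"
    by (simp add: cmod_power2 sum_negf)
  also have "\<dots> = (\<Sum>t\<in>A. \<Sum>u\<in>A. x t * x u * cos (of_int (t - u) * \<omega>))"
    by (simp add: power2_eq_square sum_product cos_diff algebra_simps flip: sum.distrib)
  finally show ?thesis .
qed

lemma has_integral_cos_int_multiple:
  fixes k :: int
  shows "((\<lambda>\<omega>. cos (of_int k * \<omega>)) has_integral (if k = 0 then 2 * pi else 0)) {- pi..pi}"
proof (cases "k = 0")
  case True
  then show ?thesis
    using has_integral_const_real[of "1::real" "- pi" pi] by simp
next
  case False
  have "((\<lambda>\<omega>. cos (of_int k * \<omega>)) has_integral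
      (sin (of_int k * pi) / of_int k - sin (of_int k * - pi) / of_int k)) {- pi..pi}"
    using False
    by (intro fundamental_theorem_of_calculus)
       (auto intro!: derivative_eq_intros simp flip: has_real_derivative_iff_has_vector_derivative)
  then show ?thesis
    using False by (simp add: mult.commute sin_integer_2pi)
qed

lemma integrable_mult_of_square_integrable:
  fixes f g :: "'a \<Rightarrow> real"
  assumes [measurable]: "f \<in> borel_measurable M" "g \<in> borel_measurable M"
    and "integrable M (\<lambda>x. (f x)\<^sup>2)" "integrable M (\<lambda>x. (g x)\<^sup>2)"
  shows "integrable M (\<lambda>x. f x * g x)"
proof (rule Bochner_Integration.integrable_bound)
  show "integrable M (\<lambda>x. (f x)\<^sup>2 + (g x)\<^sup>2)"
    using assms by simp
  have "\<bar>a * b\<bar> \<le> a\<^sup>2 + b\<^sup>2" for a b :: real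
    using sum_squares_bound[of "\<bar>a\<bar>" "\<bar>b\<bar>"] abs_ge_zero[of "a * b"]
    unfolding abs_mult power2_abs by linarith
  then show "AE x in M. norm (f x * g x) \<le> norm ((f x)\<^sup>2 + (g x)\<^sup>2)"
    by simp
qed simp

text \<open>
  A purely spatial increment is the case of time lag zero, and since its mean vanishes, its
  variance is its second moment.
\<close>
lemma spatial_increment_second_moment:
  assumes "intrinsically_stationary M Y \<gamma>"
  shows "integrable M (\<lambda>w. (spatial_increment Y h s t w)\<^sup>2)"
    and "prob_space.expectation M (\<lambda>w. (spatial_increment Y h s t w)\<^sup>2) = \<gamma> h 0"
proof -
  note lag0 = assms[unfolded intrinsically_stationary_def Let_def, rule_format, of t s 0 h]
  show "integrable M (\<lambda>w. (spatial_increment Y h s t w)\<^sup>2)"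
    and "prob_space.expectation M (\<lambda>w. (spatial_increment Y h s t w)\<^sup>2) = \<gamma> h 0"
    using lag0 by (auto simp: spatial_increment_def)
qed

theorem proposition1:
  fixes M :: "'w measure"
    and Y :: "int \<Rightarrow> real ^ 'd \<Rightarrow> 'w \<Rightarrow> real"
    and \<gamma> :: "real ^ 'd \<Rightarrow> int \<Rightarrow> real"
    and s h :: "real ^ 'd"
    and n :: nat
  assumes "prob_space M"
    and "\<And>t x. Y t x \<in> borel_measurable M"
    and "intrinsically_stationary M Y \<gamma>"
    and "n \<ge> 1"
  shows "(frequency_variogram M Y n h s has_integral \<gamma> h 0) {- pi..pi}"
proof -
  define X where "X = spatial_increment Y h s"
  define c where "c t u = prob_space.expectation M (\<lambda>w. X t w * X u w)" for t u
  define T where "T = {1..int n}"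

  have meas: "X t \<in> borel_measurable M" for t
    using assms(2) unfolding X_def spatial_increment_def by measurable
  have prod_integrable: "integrable M (\<lambda>w. X t w * X u w)" for t u
    using integrable_mult_of_square_integrable[OF meas meas]
      spatial_increment_second_moment(1)[OF assms(3)] by (simp add: X_def)
  have diag: "c t t = \<gamma> h 0" for t
    using spatial_increment_second_moment(2)[OF assms(3)]
    by (simp add: c_def X_def power2_eq_square)

  have dft_squared: "(cmod (dft n X \<omega> w))\<^sup>2
      = (\<Sum>t\<in>T. \<Sum>u\<in>T. X t w * X u w * cos (of_int (t - u) * \<omega>)) / (2 * pi * n)" for \<omega> w
    unfolding dft_def norm_mult power_mult_distrib cmod_trig_poly_squared T_def
    by (simp add: norm_divide power_divide)
  have variogram: "frequency_variogram M Y n h s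
      = (\<lambda>\<omega>. (\<Sum>t\<in>T. \<Sum>u\<in>T. c t u * cos (of_int (t - u) * \<omega>)) / (2 * pi * n))"
    unfolding frequency_variogram_def X_def[symmetric] dft_squared c_def
    using prod_integrable by (simp add: Bochner_Integration.integral_sum)

  have "((\<lambda>\<omega>. (\<Sum>t\<in>T. \<Sum>u\<in>T. c t u * cos (of_int (t - u) * \<omega>)) / (2 * pi * n)) has_integral
      (\<Sum>t\<in>T. \<Sum>u\<in>T. c t u * (if t - u = 0 then 2 * pi else 0)) / (2 * pi * n)) {- pi..pi}"
    by (intro has_integral_divide has_integral_sum has_integral_mult_right
        has_integral_cos_int_multiple) (simp_all add: T_def)
  moreover have "(\<Sum>t\<in>T. \<Sum>u\<in>T. c t u * (if t - u = 0 then 2 * pi else 0)) / (2 * pi * n) = \<gamma> h 0"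
  proof -
    have "(\<Sum>u\<in>T. c t u * (if t - u = 0 then 2 * pi else 0)) = \<gamma> h 0 * (2 * pi)" if "t \<in> T" for t
      using that diag by (simp add: T_def if_distrib cong: if_cong)
    then show ?thesis
      using assms(4) by (simp add: T_def)
  qed
  ultimately show ?thesis
    unfolding variogram by simp
qed

end
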